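(* Let $(P,\le,{}',0,1)$ be a Boolean poset satisfying the ACC and the DCC. For subsets $A,B\subseteq P$ (elements identified with singletons) define \[A+B:=\operatorname{Min}U\big(\operatorname{Max}L(A'\cup B)\cup\operatorname{Max}L(A\cup B')\big),\qquad A\cdot B:=\operatorname{Max}L(A\cup B),\] where $A':=\{a'\mid a\in A\}$. Then $(P,+,\cdot,0,1)$ is a dual of a Boolean poset.
   Context: ACC/DCC: no infinite strictly ascending/descending chains. For $X\subseteq P$: $L(X)$, $U(X)$ are the sets of lower/upper bounds of $X$; $\operatorname{Max}$, $\operatorname{Min}$ the sets of maximal/minimal elements; $\operatorname{Max}L(X)=\operatorname{Max}(L(X))$, $\operatorname{Min}U(X)=\operatorname{Min}(U(X))$; $L(x,y)=L(\{x,y\})$, $LU(X)=L(U(X))$. A complemented poset is a bounded poset $(P,\le,{}',0,1)$ with an antitone involution $'$ such that $L(x,x')=\{0\}$, $U(x,x')=\{1\}$. A poset is distributive if $L(U(x,y),z)=LU(L(x,z),L(y,z))$ for all $x,y,z$. A Boolean poset is a distributive complemented poset. A dual of a Boolean poset is a structure $(P,+,\cdot,0,1)$ where $+,\cdot$ are binary operators on $P$ (defined on pairs of elements and of subsets, with values subsets of $P$; elements identified with singletons), $0,1\in P$, such that for all $x,y,z\in P$ and $A,B\subseteq P$: (i) $x\cdot x=x$, $x\cdot y=y\cdot x$, $x\cdot0=0$, $x\cdot1=x$, $(x\cdot(y\cdot z))\cdot z=(x\cdot(y\cdot z))\cdot1$; (ii) $(x+1)+1=x$; (iii) $x\cdot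 y=x$ implies $(x+1)\cdot(y+1)=y+1$; (iv) $x\cdot(x+1)=0$; (v) $\Big(\big((x+1)\cdot(y+1)\big)+1\Big)\cdot z=\Big(\big(((x\cdot z)+1)\cdot((y\cdot z)+1)\big)+1\Big)\cdot1$; (vi) $x\in A\cdot B$ if and only if [$x\cdot y=x$ for all $y\in A\cup B$, and every $z\in P$ with $x\cdot z=x$ and $z\cdot y=z$ for all $y\in A\cup B$ satisfies $z=x$]. *)

theory Defs
  imports "HOL-Algebra.Order"
begin

text \<open>
  A poset is a record satisfying \<^locale>\<open>partial_order\<close>; that locale forces the
  equivalence field of the record to be equality. \<^term>\<open>Lower P X\<close> and \<^term>\<open>Upper P X\<close> are
  the sets of lower and upper bounds in \<^term>\<open>carrier P\<close>, and equal \<^term>\<open>carrier P\<close>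
  for empty \<open>X\<close>.
\<close>

definition Maximals :: "('a, 'b) gorder_scheme \<Rightarrow> 'a set \<Rightarrow> 'a set" where
  "Maximals P X = {m \<in> X. \<not> (\<exists>x\<in>X. m \<sqsubset>\<^bsub>P\<^esub> x)}"

definition Minimals :: "('a, 'b) gorder_scheme \<Rightarrow> 'a set \<Rightarrow> 'a set" where
  "Minimals P X = {m \<in> X. \<not> (\<exists>x\<in>X. x \<sqsubset>\<^bsub>P\<^esub> m)}"

definition ACC :: "('a, 'b) gorder_scheme \<Rightarrow> bool" where
  "ACC P \<longleftrightarrow> \<not> (\<exists>f :: nat \<Rightarrow> 'a. \<forall>i. f i \<in> carrier P \<and> f i \<sqsubset>\<^bsub>P\<^esub> f (Suc i))"

definition DCC :: "('a, 'b) gorder_scheme \<Rightarrow> bool" where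
  "DCC P \<longleftrightarrow> \<not> (\<exists>f :: nat \<Rightarrow> 'a. \<forall>i. f i \<in> carrier P \<and> f (Suc i) \<sqsubset>\<^bsub>P\<^esub> f i)"

locale complemented_poset = partial_order P
  for P :: "('a, 'b) gorder_scheme" (structure) +
  fixes compl :: "'a \<Rightarrow> 'a" and zero one :: 'a
  assumes zero_least: "least P zero (carrier P)"
    and one_greatest: "greatest P one (carrier P)"
    and compl_closed: "x \<in> carrier P \<Longrightarrow> compl x \<in> carrier P"
    and compl_antitone:
      "\<lbrakk>x \<in> carrier P; y \<in> carrier P; x \<sqsubseteq> y\<rbrakk> \<Longrightarrow> compl y \<sqsubseteq> compl x"
    and compl_involution: "x \<in> carrier P \<Longrightarrow> compl (compl x) = x"
    and Lower_compl: "x \<in> carrier P \<Longrightarrow> Lower P {x, compl x} = {zero}"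
    and Upper_compl: "x \<in> carrier P \<Longrightarrow> Upper P {x, compl x} = {one}"

text \<open>
  Several arguments of \<open>L\<close> or \<open>U\<close> stand for their union, so \<open>L(U(x,y),z)\<close> is the set of
  lower bounds of \<open>U(x,y) \<union> {z}\<close>.
\<close>

locale boolean_poset = complemented_poset +
  assumes distributive:
    "\<lbrakk>x \<in> carrier P; y \<in> carrier P; z \<in> carrier P\<rbrakk> \<Longrightarrow>
      Lower P (Upper P {x, y} \<union> {z}) =
      Lower P (Upper P (Lower P {x, z} \<union> Lower P {y, z}))"

text \<open>
  The binary operators are functions on subsets of \<open>P\<close> with values subsets of \<open>P\<close>; an element
  \<open>x\<close> occurs as the singleton \<open>{x}\<close>. Their behaviour outside the subsets of \<open>P\<close> is irrelevant.
\<close>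

locale dual_of_boolean_poset =
  fixes P :: "'a set"
    and plus :: "'a set \<Rightarrow> 'a set \<Rightarrow> 'a set"  (infixl \<open>\<oplus>\<close> 65)
    and times :: "'a set \<Rightarrow> 'a set \<Rightarrow> 'a set"  (infixl \<open>\<odot>\<close> 70)
    and zero one :: 'a
  assumes plus_closed: "\<lbrakk>A \<subseteq> P; B \<subseteq> P\<rbrakk> \<Longrightarrow> A \<oplus> B \<subseteq> P"
    and times_closed: "\<lbrakk>A \<subseteq> P; B \<subseteq> P\<rbrakk> \<Longrightarrow> A \<odot> B \<subseteq> P"
    and zero_closed: "zero \<in> P"
    and one_closed: "one \<in> P"
    and times_idem: "x \<in> P \<Longrightarrow> {x} \<odot> {x} = {x}"
    and times_comm: "\<lbrakk>x \<in> P; y \<in> P\<rbrakk> \<Longrightarrow> {x} \<odot> {y} = {y} \<odot> {x}"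
    and times_zero: "x \<in> P \<Longrightarrow> {x} \<odot> {zero} = {zero}"
    and times_one: "x \<in> P \<Longrightarrow> {x} \<odot> {one} = {x}"
    and times_absorb:
      "\<lbrakk>x \<in> P; y \<in> P; z \<in> P\<rbrakk> \<Longrightarrow>
        ({x} \<odot> ({y} \<odot> {z})) \<odot> {z} = ({x} \<odot> ({y} \<odot> {z})) \<odot> {one}"
    and plus_one_plus_one: "x \<in> P \<Longrightarrow> ({x} \<oplus> {one}) \<oplus> {one} = {x}"
    and plus_one_antitone:
      "\<lbrakk>x \<in> P; y \<in> P; {x} \<odot> {y} = {x}\<rbrakk> \<Longrightarrow>
        ({x} \<oplus> {one}) \<odot> ({y} \<oplus> {one}) = {y} \<oplus> {one}"
    and times_plus_one: "x \<in> P \<Longrightarrow> {x} \<odot> ({x} \<oplus> {one}) = {zero}"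
    and distrib:
      "\<lbrakk>x \<in> P; y \<in> P; z \<in> P\<rbrakk> \<Longrightarrow>
        ((({x} \<oplus> {one}) \<odot> ({y} \<oplus> {one})) \<oplus> {one}) \<odot> {z} =
        (((({x} \<odot> {z}) \<oplus> {one}) \<odot> (({y} \<odot> {z}) \<oplus> {one})) \<oplus> {one}) \<odot> {one}"
    and mem_times_iff:
      "\<lbrakk>x \<in> P; A \<subseteq> P; B \<subseteq> P\<rbrakk> \<Longrightarrow>
        x \<in> A \<odot> B \<longleftrightarrow>
          (\<forall>y \<in> A \<union> B. {x} \<odot> {y} = {x}) \<and>
          (\<forall>z \<in> P. {x} \<odot> {z} = {x} \<and> (\<forall>y \<in> A \<union> B. {z} \<odot> {y} = {z}) \<longrightarrow> z = x)"

definition poset_times :: "('a, 'b) gorder_scheme \<Rightarrow> 'a set \<Rightarrow> 'a set \<Rightarrow> 'a set" where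
  "poset_times P A B = Maximals P (Lower P (A \<union> B))"

definition poset_plus ::
    "('a, 'b) gorder_scheme \<Rightarrow> ('a \<Rightarrow> 'a) \<Rightarrow> 'a set \<Rightarrow> 'a set \<Rightarrow> 'a set" where
  "poset_plus P compl A B =
    Minimals P (Upper P
      (Maximals P (Lower P (compl ` A \<union> B)) \<union> Maximals P (Lower P (A \<union> compl ` B))))"

end

theory Submission
  imports Defs
begin

text \<open>
  By ACC and DCC, replacing \<open>L(X)\<close> by \<open>Max L(X)\<close> does not change its upper bounds, and dually.
  Hence \<open>A + 1 = Min U L(A')\<close>, and since \<open>'\<close> exchanges \<open>L\<close> and \<open>U\<close>, \<open>(Max L(X)) + 1 = Min U(X')\<close>.
  Both sides of axiom (v) thereby reduce to \<open>Max\<close> of the two sides of the distributive law.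
\<close>

section \<open>Lower and upper cones, chain conditions, and the product \<open>Max L\<close>\<close>

lemma Maximals_subset: "Maximals P X \<subseteq> X"
  by (auto simp: Maximals_def)

lemma Minimals_subset: "Minimals P X \<subseteq> X"
  by (auto simp: Minimals_def)

lemma Lower_Un: "Lower P (A \<union> B) = Lower P A \<inter> Lower P B"
  by (auto simp: Lower_def)

lemma Upper_Un: "Upper P (A \<union> B) = Upper P A \<inter> Upper P B"
  by (auto simp: Upper_def)

lemma Upper_Lower_Upper: "Upper P (Lower P (Upper P X)) = Upper P X"
  by (auto simp: Upper_def Lower_def)

lemma poset_times_subset: "poset_times P A B \<subseteq> Lower P B"
  unfolding poset_times_def by (rule subset_trans[OF Maximals_subset Lower_antimono]) simp

context partial_order
begin

text \<open>Otherwise each element of \<open>X\<close> above \<open>x\<close> has a strictly larger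
  one in \<open>X\<close>, again above \<open>x\<close>, and dependent choice builds an infinite
  ascending chain.\<close>

lemma ex_Maximals_above:
  assumes "ACC L" "X \<subseteq> carrier L" "x \<in> X"
  shows "\<exists>m\<in>Maximals L X. x \<sqsubseteq> m"
proof (rule ccontr)
  assume none: "\<not> ?thesis"
  define Y where "Y = {y \<in> X. x \<sqsubseteq> y}"
  have "\<exists>z. z \<in> Y \<and> y \<sqsubset> z" if y: "y \<in> Y" for y
  proof -
    have "y \<notin> Maximals L X" using none y by (auto simp: Y_def)
    then obtain z where z: "z \<in> X" "y \<sqsubset> z" using y by (auto simp: Y_def Maximals_def)
    then have "x \<sqsubseteq> z" using y assms le_trans[of x y z] by (auto simp: Y_def lless_eq)
    with z show ?thesis by (auto simp: Y_def)
  qed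
  moreover have "x \<in> Y" using assms by (auto simp: Y_def)
  ultimately obtain f :: "nat \<Rightarrow> 'a" where "\<forall>n. f n \<in> Y \<and> f n \<sqsubset> f (Suc n)"
    using dependent_nat_choice[of "\<lambda>_ y. y \<in> Y" "\<lambda>_ y z. y \<sqsubset> z"] by blast
  moreover have "Y \<subseteq> carrier L" using assms by (auto simp: Y_def)
  ultimately show False using assms(1) unfolding ACC_def by blast
qed

text \<open>Each element of \<open>X\<close> lies below a maximal one, so bounding the maximal
  elements bounds all of \<open>X\<close>.\<close>

lemma Upper_Maximals:
  assumes "ACC L" "X \<subseteq> carrier L"
  shows "Upper L (Maximals L X) = Upper L X"
proof
  show "Upper L X \<subseteq> Upper L (Maximals L X)"
    by (rule Upper_antimono[OF Maximals_subset])
  show "Upper L (Maximals L X) \<subseteq> Upper L X"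
  proof
    fix u assume u: "u \<in> Upper L (Maximals L X)"
    then have uc: "u \<in> carrier L" by (auto simp: Upper_def)
    show "u \<in> Upper L X"
    proof (rule Upper_memI[OF _ uc])
      fix x assume x: "x \<in> X"
      then obtain m where m: "m \<in> Maximals L X" "x \<sqsubseteq> m"
        using ex_Maximals_above assms by blast
      have mc: "m \<in> carrier L" using m assms(2) by (auto simp: Maximals_def)
      then have "m \<sqsubseteq> u" using u m by (auto simp: Upper_def)
      with m(2) show "x \<sqsubseteq> u" using le_trans[of x m u] x mc uc assms(2) by auto
    qed
  qed
qed

lemma Maximals_dual: "Maximals (inv_gorder L) X = Minimals L X"
  by (auto simp: Maximals_def Minimals_def lless_def eq_is_equal)

lemma ACC_dual: "ACC (inv_gorder L) \<longleftrightarrow> DCC L"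
proof -
  have "(a \<sqsubset>\<^bsub>inv_gorder L\<^esub> b) = (b \<sqsubset> a)" for a b
    by (auto simp: lless_def eq_is_equal)
  then show ?thesis by (simp add: ACC_def DCC_def)
qed

text \<open>This is \<open>Upper_Maximals\<close> read in the opposite order
  \<open>inv_gorder L\<close>.\<close>

lemma Lower_Minimals:
  assumes "DCC L" "X \<subseteq> carrier L"
  shows "Lower L (Minimals L X) = Lower L X"
  using partial_order.Upper_Maximals[OF dual_order, of X] assms
  by (simp add: Maximals_dual ACC_dual)

text \<open>The bottom \<open>b\<close> is always a lower bound, and ACC gives a maximal lower bound
  above it.\<close>

lemma poset_times_nonempty:
  assumes "ACC L" "least L b (carrier L)"
  shows "poset_times L A B \<noteq> {}"
proof -
  have "b \<in> Lower L (A \<union> B)" using assms(2) by (auto simp: Lower_def least_def)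
  then show ?thesis
    using ex_Maximals_above[OF assms(1) Lower_closed] unfolding poset_times_def by blast
qed

text \<open>By antisymmetry an infimum excludes every other maximal lower bound; this evaluates
  products of comparable elements.\<close>

lemma Maximals_Lower_eq_singleton:
  assumes "greatest L x (Lower L X)"
  shows "Maximals L (Lower L X) = {x}"
proof -
  have "y = x" if "y \<in> Lower L X" "x \<sqsubseteq> y" for y
    using that assms by (intro le_antisym) (auto simp: greatest_def Lower_def)
  then show ?thesis using assms by (auto simp: Maximals_def greatest_def lless_eq)
qed

lemma Minimals_Upper_eq_singleton:
  assumes "least L x (Upper L X)"
  shows "Minimals L (Upper L X) = {x}"
proof -
  have "y = x" if "y \<in> Upper L X" "y \<sqsubseteq> x" for y
    using that assms by (intro le_antisym) (auto simp: least_def Upper_def)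
  then show ?thesis using assms by (auto simp: Minimals_def least_def lless_eq)
qed

lemma Lower_singleton: "x \<in> carrier L \<Longrightarrow> greatest L x (Lower L {x})"
  by (auto simp: greatest_def Lower_def)

lemma Upper_singleton: "x \<in> carrier L \<Longrightarrow> least L x (Upper L {x})"
  by (auto simp: least_def Upper_def)

text \<open>The axioms express the order through equations of this shape; the equivalence translates
  them back.\<close>

lemma poset_times_singletons_iff:
  assumes "x \<in> carrier L" "y \<in> carrier L"
  shows "poset_times L {x} {y} = {x} \<longleftrightarrow> x \<sqsubseteq> y"
proof
  assume "poset_times L {x} {y} = {x}"
  then have "x \<in> Lower L {x, y}" using Maximals_subset[of L "Lower L {x, y}"]
    by (auto simp: poset_times_def insert_commute)
  then show "x \<sqsubseteq> y" using assms by (auto simp: Lower_def)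
next
  assume "x \<sqsubseteq> y"
  then have "greatest L x (Lower L ({x} \<union> {y}))"
    using assms by (auto simp: greatest_def Lower_def)
  then show "poset_times L {x} {y} = {x}"
    unfolding poset_times_def by (rule Maximals_Lower_eq_singleton)
qed

text \<open>Each member of the inner product is below \<open>z\<close>, and so is each lower bound
  of that nonempty product. Adjoining \<open>z\<close> thus constrains the lower bounds no more than
  adjoining the top \<open>t\<close>.\<close>

lemma poset_times_absorb:
  assumes "ACC L" "least L b (carrier L)" "greatest L t (carrier L)" "z \<in> carrier L"
  shows "poset_times L (poset_times L {x} (poset_times L {y} {z})) {z} =
    poset_times L (poset_times L {x} (poset_times L {y} {z})) {t}"
proof -
  define D where "D = poset_times L {y} {z}"
  define E where "E = poset_times L {x} D"
  have D: "D \<noteq> {}" "D \<subseteq> Lower L {z}"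
    unfolding D_def by (rule poset_times_nonempty[OF assms(1,2)] poset_times_subset)+
  have E: "E \<noteq> {}" "E \<subseteq> Lower L D"
    unfolding E_def by (rule poset_times_nonempty[OF assms(1,2)] poset_times_subset)+
  \<comment> \<open>Any \<open>d\<close> in \<open>D\<close> links \<open>e\<close> to
    \<open>z\<close>; nonemptiness of \<open>D\<close> supplies one.\<close>
  have below_z: "e \<sqsubseteq> z \<and> e \<in> carrier L" if e: "e \<in> E" for e
  proof -
    obtain d where d: "d \<in> D" using D by blast
    have "d \<in> carrier L" "d \<sqsubseteq> z" using D d assms(4) by (auto simp: Lower_def)
    moreover have "e \<in> carrier L" "e \<sqsubseteq> d" using E e d \<open>d \<in> carrier L\<close> by (auto simp: Lower_def)
    ultimately show ?thesis using le_trans assms(4) by blast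
  qed
  have "Lower L E \<subseteq> Lower L {z}"
  proof
    fix l assume l: "l \<in> Lower L E"
    obtain e where e: "e \<in> E" using E by blast
    then have "l \<sqsubseteq> e" "l \<in> carrier L" using l below_z by (auto simp: Lower_def)
    then have "l \<sqsubseteq> z" using le_trans below_z[OF e] assms(4) by blast
    with \<open>l \<in> carrier L\<close> show "l \<in> Lower L {z}" by (auto simp: Lower_def)
  qed
  moreover have "Lower L E \<subseteq> Lower L {t}"
    using assms(3) by (auto simp: Lower_def greatest_def)
  ultimately have "Lower L (E \<union> {z}) = Lower L (E \<union> {t})"
    unfolding Lower_Un by blast
  then show ?thesis unfolding E_def D_def poset_times_def by simp
qed

text \<open>Read through \<open>poset_times_singletons_iff\<close>, the right side says that
  \<open>x\<close> is a lower bound with no other lower bound above it.\<close>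

lemma mem_poset_times_iff:
  assumes "x \<in> carrier L" "A \<subseteq> carrier L" "B \<subseteq> carrier L"
  shows "x \<in> poset_times L A B \<longleftrightarrow>
    (\<forall>y \<in> A \<union> B. poset_times L {x} {y} = {x}) \<and>
    (\<forall>z \<in> carrier L. poset_times L {x} {z} = {x} \<and>
      (\<forall>y \<in> A \<union> B. poset_times L {z} {y} = {z}) \<longrightarrow> z = x)"
proof -
  have times: "(\<forall>y \<in> A \<union> B. poset_times L {u} {y} = {u}) \<longleftrightarrow> (\<forall>y \<in> A \<union> B. u \<sqsubseteq> y)"
    if "u \<in> carrier L" for u
    using that assms(2,3) poset_times_singletons_iff by blast
  \<comment> \<open>\<open>Lower\<close> tests only elements of the carrier; since \<open>A\<close>
    and \<open>B\<close> lie in it, the restriction disappears.\<close>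
  have mem_Lower: "u \<in> Lower L (A \<union> B) \<longleftrightarrow> u \<in> carrier L \<and> (\<forall>y \<in> A \<union> B. u \<sqsubseteq> y)" for u
    using assms(2,3) unfolding Lower_def by blast
  have "x \<in> poset_times L A B \<longleftrightarrow> (\<forall>y \<in> A \<union> B. x \<sqsubseteq> y) \<and>
    (\<forall>z \<in> carrier L. x \<sqsubseteq> z \<and> (\<forall>y \<in> A \<union> B. z \<sqsubseteq> y) \<longrightarrow> z = x)"
    using assms(1) by (auto simp: poset_times_def Maximals_def lless_eq mem_Lower)
  also have "\<dots> \<longleftrightarrow> (\<forall>y \<in> A \<union> B. poset_times L {x} {y} = {x}) \<and>
    (\<forall>z \<in> carrier L. poset_times L {x} {z} = {x} \<and>
      (\<forall>y \<in> A \<union> B. poset_times L {z} {y} = {z}) \<longrightarrow> z = x)"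
    using times poset_times_singletons_iff assms(1) by simp
  finally show ?thesis .
qed

end

section \<open>Complementation as an order-reversing involution, and the operation
  \<open>A + 1\<close>\<close>

context complemented_poset
begin

lemma zero_closed: "zero \<in> carrier P" and one_closed: "one \<in> carrier P"
  using zero_least one_greatest by auto

text \<open>As \<open>one\<close> is greatest, \<open>compl one\<close> is a lower bound of
  \<open>one\<close> and itself, and \<open>zero\<close> is the only such bound.\<close>

lemma compl_one: "compl one = zero"
proof -
  have "compl one \<in> Lower P {one, compl one}"
    using one_greatest compl_closed by (auto simp: Lower_def greatest_def)
  then show ?thesis using Lower_compl one_closed by auto
qed

lemma compl_image_closed: "X \<subseteq> carrier P \<Longrightarrow> compl ` X \<subseteq> carrier P"
  using compl_closed by auto

lemma compl_image_involution: "X \<subseteq> carrier P \<Longrightarrow> compl ` compl ` X = X"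
  using compl_involution by (simp add: image_image subset_iff)

lemma compl_le_iff:
  "x \<in> carrier P \<Longrightarrow> y \<in> carrier P \<Longrightarrow> compl x \<sqsubseteq> compl y \<longleftrightarrow> y \<sqsubseteq> x"
  by (metis compl_antitone compl_closed compl_involution)

lemma compl_less_iff:
  "x \<in> carrier P \<Longrightarrow> y \<in> carrier P \<Longrightarrow> compl x \<sqsubset> compl y \<longleftrightarrow> y \<sqsubset> x"
  by (metis compl_le_iff compl_involution lless_eq)

lemma compl_image_Maximals:
  "X \<subseteq> carrier P \<Longrightarrow> compl ` Maximals P X = Minimals P (compl ` X)"
  by (auto simp: Maximals_def Minimals_def compl_less_iff subset_iff)

lemma compl_image_Lower:
  assumes "X \<subseteq> carrier P"
  shows "compl ` Lower P X = Upper P (compl ` X)"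
proof
  show "compl ` Lower P X \<subseteq> Upper P (compl ` X)"
    using assms by (auto simp: Lower_def Upper_def compl_le_iff compl_closed subset_iff)
  show "Upper P (compl ` X) \<subseteq> compl ` Lower P X"
  proof
    fix u assume u: "u \<in> Upper P (compl ` X)"
    then have uc: "u \<in> carrier P" by (auto simp: Upper_def)
    \<comment> \<open>By involution, \<open>compl u\<close> is the required preimage of
      \<open>u\<close>.\<close>
    have "compl u \<in> Lower P X"
    proof (rule Lower_memI[OF _ compl_closed[OF uc]])
      fix x assume x: "x \<in> X"
      then have xc: "x \<in> carrier P" using assms by auto
      then have "compl x \<sqsubseteq> u" using u x by (auto simp: Upper_def compl_closed)
      then show "compl u \<sqsubseteq> x" by (metis compl_antitone compl_closed compl_involution uc xc)
    qed
    then show "u \<in> compl ` Lower P X" by (metis compl_involution imageI uc)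
  qed
qed

text \<open>In the first term \<open>one\<close> adds no constraint to the lower bounds. In the
  second, \<open>compl one = zero\<close> collapses the maximal lower bounds to \<open>zero\<close>,
  which constrains no upper bound. ACC then removes the remaining \<open>Max\<close>.\<close>

lemma poset_plus_one:
  assumes "ACC P" "A \<subseteq> carrier P"
  shows "poset_plus P compl A {one} = Minimals P (Upper P (Lower P (compl ` A)))"
proof -
  have "Lower P (compl ` A) \<subseteq> Lower P {one}"
    using one_greatest by (auto simp: Lower_def greatest_def)
  then have 1: "Lower P (compl ` A \<union> {one}) = Lower P (compl ` A)"
    unfolding Lower_Un by blast
  have "greatest P zero (Lower P (A \<union> compl ` {one}))"
    using assms(2) zero_least by (auto simp: greatest_def Lower_def least_def compl_one)
  then have 2: "Maximals P (Lower P (A \<union> compl ` {one})) = {zero}"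
    by (rule Maximals_Lower_eq_singleton)
  have "Upper P X \<subseteq> Upper P {zero}" for X
    using zero_least by (auto simp: Upper_def least_def)
  then have "Upper P (Maximals P (Lower P (compl ` A)) \<union> {zero}) =
      Upper P (Lower P (compl ` A))"
    unfolding Upper_Un using Upper_Maximals[OF assms(1) Lower_closed] by auto
  then show ?thesis unfolding poset_plus_def 1 2 by simp
qed

text \<open>With \<open>A = Max L(X)\<close> one has \<open>A' = Min U(X')\<close>; DCC gives
  \<open>L(A') = LU(X')\<close>, and \<open>ULU = U\<close> finishes.\<close>

lemma poset_plus_one_Maximals_Lower:
  assumes "ACC P" "DCC P" "X \<subseteq> carrier P"
  shows "poset_plus P compl (Maximals P (Lower P X)) {one} = Minimals P (Upper P (compl ` X))"
proof -
  have "Maximals P (Lower P X) \<subseteq> carrier P"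
    using Maximals_subset Lower_closed by (rule subset_trans)
  then show ?thesis
    by (simp add: poset_plus_one assms compl_image_Maximals compl_image_Lower
        Lower_Minimals Upper_Lower_Upper)
qed

text \<open>The preceding result applies because \<open>{x} = Max L({x})\<close>; likewise
  \<open>Min U({x'}) = {x'}\<close>.\<close>

lemma poset_plus_one_singleton:
  assumes "ACC P" "DCC P" "x \<in> carrier P"
  shows "poset_plus P compl {x} {one} = {compl x}"
  using poset_plus_one_Maximals_Lower[of "{x}"] assms
    Maximals_Lower_eq_singleton[OF Lower_singleton]
    Minimals_Upper_eq_singleton[OF Upper_singleton] compl_closed
  by simp

end

section \<open>The distributive axiom (v)\<close>

lemma (in boolean_poset) poset_times_distrib:
  assumes "ACC P" "DCC P" and xyz: "x \<in> carrier P" "y \<in> carrier P" "z \<in> carrier P"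
  defines "neg \<equiv> \<lambda>A. poset_plus P compl A {one}"
  shows "poset_times P (neg (poset_times P (neg {x}) (neg {y}))) {z} =
    poset_times P (neg (poset_times P (neg (poset_times P {x} {z}))
      (neg (poset_times P {y} {z})))) {one}"
proof -
  have neg_times: "neg (poset_times P A B) = Minimals P (Upper P (compl ` (A \<union> B)))"
    if "A \<subseteq> carrier P" "B \<subseteq> carrier P" for A B
    unfolding neg_def poset_times_def
    using poset_plus_one_Maximals_Lower[OF assms(1,2), of "A \<union> B"] that by simp
  \<comment> \<open>\<open>L\<close> of a union is an intersection, so DCC removes
    \<open>Min\<close> even beside another set.\<close>
  have Lower_Min: "Lower P (Minimals P (Upper P X) \<union> Y) = Lower P (Upper P X \<union> Y)" for X Y
    unfolding Lower_Un Lower_Minimals[OF assms(2) Upper_closed] ..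
  have compl_Upper: "compl ` Upper P {compl u, compl z} = Lower P {u, z}"
    if "u \<in> carrier P" for u
    using compl_image_Lower[of "{u, z}"] compl_image_involution[OF Lower_closed] that xyz
    by (metis empty_subsetI image_empty image_insert insert_subset)
  have "neg {x} = {compl x}" "neg {y} = {compl y}"
    unfolding neg_def using poset_plus_one_singleton assms by auto
  then have "neg (poset_times P (neg {x}) (neg {y})) = Minimals P (Upper P {x, y})"
    using xyz by (simp add: neg_times compl_closed compl_involution insert_commute)
  then have "poset_times P (neg (poset_times P (neg {x}) (neg {y}))) {z} =
      Maximals P (Lower P (Upper P {x, y} \<union> {z}))"
    by (simp only: poset_times_def Lower_Min)
  moreover have "poset_times P (neg (poset_times P (neg (poset_times P {x} {z}))
      (neg (poset_times P {y} {z})))) {one} =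
      Maximals P (Lower P (Upper P (Lower P {x, z} \<union> Lower P {y, z})))"
  proof -
    let ?Ux = "Upper P {compl x, compl z}" and ?Uy = "Upper P {compl y, compl z}"
    have "poset_times P (neg (poset_times P {x} {z})) (neg (poset_times P {y} {z})) =
        poset_times P ?Ux ?Uy"
      \<comment> \<open>The factors first become \<open>Min ?Ux\<close> and \<open>Min ?Uy\<close>;
        the second \<open>simp\<close> drops both \<open>Min\<close>, as the product uses only their
        lower bounds.\<close>
      using xyz by (simp add: neg_times insert_commute[of "compl z"])
        (simp add: poset_times_def Lower_Un Lower_Minimals[OF assms(2)])
    then have "neg (poset_times P (neg (poset_times P {x} {z})) (neg (poset_times P {y} {z}))) =
        Minimals P (Upper P (Lower P {x, z} \<union> Lower P {y, z}))"
      \<comment> \<open>The outer complement sends \<open>?Ux\<close> and \<open>?Uy\<close> back to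
        the cones \<open>L(x,z)\<close> and \<open>L(y,z)\<close>.\<close>
      using xyz by (simp add: neg_times image_Un compl_Upper)
    \<comment> \<open>Multiplying by \<open>one\<close> therefore contributes only the outer
      \<open>Max L\<close>.\<close>
    moreover have "Lower P (A \<union> {one}) = Lower P A" for A
      using one_greatest by (auto simp: Lower_def greatest_def)
    ultimately show ?thesis
      by (simp only: poset_times_def Lower_Minimals[OF assms(2) Upper_closed])
  qed
  ultimately show ?thesis using distributive[OF xyz] by simp
qed

section \<open>Verification of the axioms for the poset operations\<close>

theorem theorem5p2:
  fixes P :: "('a, 'b) gorder_scheme" and compl :: "'a \<Rightarrow> 'a" and zero one :: 'a
  assumes "boolean_poset P compl zero one"
    and "ACC P" and "DCC P"
  shows "dual_of_boolean_poset (carrier P) (poset_plus P compl) (poset_times P) zero one"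
proof -
  interpret boolean_poset P compl zero one by fact
  note neg = poset_plus_one_singleton[OF assms(2,3)]
  show ?thesis
  proof
    show "poset_plus P compl A B \<subseteq> carrier P" for A B
      unfolding poset_plus_def using Minimals_subset Upper_closed by (rule subset_trans)
    show "poset_times P A B \<subseteq> carrier P" for A B
      unfolding poset_times_def using Maximals_subset Lower_closed by (rule subset_trans)
    show comm: "poset_times P {x} {y} = poset_times P {y} {x}" for x y
      by (simp add: poset_times_def insert_commute)
    fix x assume x: "x \<in> carrier P"
    show "poset_times P {x} {x} = {x}"
      using x by (simp add: poset_times_singletons_iff)
    show "poset_times P {x} {one} = {x}"
      using x one_greatest by (auto simp: poset_times_singletons_iff greatest_def)
    show "poset_times P {x} {zero} = {zero}"
      \<comment> \<open>Commuting puts the smaller factor \<open>zero\<close> first, as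
        \<open>poset_times_singletons_iff\<close> requires.\<close>
      unfolding comm[of x] using x zero_least by (auto simp: poset_times_singletons_iff least_def)
    show "poset_plus P compl (poset_plus P compl {x} {one}) {one} = {x}"
      using x by (simp add: neg compl_closed compl_involution)
    show "poset_times P {x} (poset_plus P compl {x} {one}) = {zero}"
      \<comment> \<open>Since \<open>x + 1\<close> is \<open>compl x\<close>, the product is
        \<open>Max L(x,x') = Max {zero}\<close>.\<close>
      using x Lower_compl[OF x] Lower_singleton[OF zero_closed]
      by (auto simp: neg poset_times_def Maximals_def lless_def insert_commute eq_is_equal)
  next
    fix x y assume xy: "x \<in> carrier P" "y \<in> carrier P" "poset_times P {x} {y} = {x}"
    \<comment> \<open>The hypothesis means \<open>x \<sqsubseteq> y\<close>; antitonicity reverses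
      it, hence the swapped factors.\<close>
    then have "poset_times P {compl y} {compl x} = {compl y}"
      by (simp add: poset_times_singletons_iff compl_closed compl_antitone)
    then show "poset_times P (poset_plus P compl {x} {one}) (poset_plus P compl {y} {one}) =
        poset_plus P compl {y} {one}"
      using xy by (simp add: neg poset_times_def insert_commute)
  next
    fix x y z assume "x \<in> carrier P" "y \<in> carrier P" "z \<in> carrier P"
    then show "poset_times P (poset_times P {x} (poset_times P {y} {z})) {z} =
        poset_times P (poset_times P {x} (poset_times P {y} {z})) {one}"
      using poset_times_absorb[OF assms(2) zero_least one_greatest] by blast
  \<comment> \<open>Left over are membership of \<open>zero\<close> and \<open>one\<close> in the
    carrier and axioms (v) and (vi).\<close>
  qed (use zero_closed one_closed poset_times_distrib[OF assms(2,3)] mem_poset_times_iff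
      in \<open>simp_all del: Un_insert_right\<close>)
qed

end
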